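(* Let $A$ be a two-sided brace. Then the Baer radical of $A$ is zero if and only if the Wedderburn radical of $A$ is zero, i.e. $B(A)=0$ if and only if $W(A)=0$.
   Context: A skew brace is a triple $(A,+,\circ)$ where $(A,+)$ and $(A,\circ)$ are (not necessarily abelian) groups with $a\circ(b+c)=a\circ b-a+a\circ c$ for all $a,b,c\in A$ (the two groups share the identity element $0$). A brace is a skew brace with abelian additive group; it is two-sided if moreover $(a+b)\circ c=a\circ c-c+b\circ c$ for all $a,b,c$. For $a,b\in A$ put $\lambda_a(b)=-a+a\circ b$ and $a*b=\lambda_a(b)-b$. For subsets $X,Y\subseteq A$, $X*Y$ denotes the subgroup of $(A,+)$ generated by $\{x*y:x\in X,\ y\in Y\}$. An ideal of $A$ is a normal subgroup $I$ of $(A,\circ)$ such that $\lambda_a(I)\subseteq I$ and $a+I=I+a$ for all $a\in A$; an ideal is itself a skew brace under the restricted operations. For $a\in A$, $\langle a\rangle$ denotes the smallest ideal of $A$ containing $a$. An $n$-sequence in $A$ is a sequence $a_1,a_2,\ldots$ of elements of $A$ with $a_{i+1}\in\langle a_i\rangle*\langle a_i\rangle$ for all $i\ge 1$. An ideal $I$ of $A$ is Baer radical if every $n$-sequence in $A$ starting with an element of $I$ reaches zero. The Baer radical $B(A)$ is the largest Baer radical ideal of $A$ (it exists: it is the sum of all Baer radical ideals). For a skew brace $A$ put $A^1=A$, $A^{n+1}=A*A^n$, and $A^{(1)}=A$, $A^{(n+1)}=A^{(n)}*A$. $A$ is left nilpotent if $A^n=0$ for some $n$, and right nilpotent if $A^{(n)}=0$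 for some $n$. An ideal is left (resp. right) nilpotent if it is left (resp. right) nilpotent as a skew brace. The Wedderburn radical $W(A)$ is the sum of all ideals of $A$ that are both left nilpotent and right nilpotent. *)

theory Defs
  imports "HOL-Algebra.AbelCoset" "HOL-Algebra.Generated_Groups"
begin

text \<open>
  A skew brace is stored in a ring record: \<open>\<oplus>\<close>, \<open>\<zero>\<close> are the additive group
  and \<open>\<otimes>\<close>, \<open>\<one>\<close> the circle group, both on the same carrier. No ring axiom is assumed.
  That the two identities agree is a consequence, see \<open>one_eq_zero\<close>.
\<close>

locale skew_brace = add: group "add_monoid A" + mult: group A for A (structure) +
  assumes brace_distrib:
    "\<lbrakk>a \<in> carrier A; b \<in> carrier A; c \<in> carrier A\<rbrakk>
      \<Longrightarrow> a \<otimes> (b \<oplus> c) = a \<otimes> b \<ominus> a \<oplus> a \<otimes> c"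

locale brace = skew_brace + abelian_group A

locale two_sided_brace = brace +
  assumes brace_distrib_right:
    "\<lbrakk>a \<in> carrier A; b \<in> carrier A; c \<in> carrier A\<rbrakk>
      \<Longrightarrow> (a \<oplus> b) \<otimes> c = a \<otimes> c \<ominus> c \<oplus> b \<otimes> c"

definition lam :: "('a, 'm) ring_scheme \<Rightarrow> 'a \<Rightarrow> 'a \<Rightarrow> 'a" where
  "lam A a b = \<ominus>\<^bsub>A\<^esub> a \<oplus>\<^bsub>A\<^esub> a \<otimes>\<^bsub>A\<^esub> b"

definition star :: "('a, 'm) ring_scheme \<Rightarrow> 'a \<Rightarrow> 'a \<Rightarrow> 'a" where
  "star A a b = lam A a b \<ominus>\<^bsub>A\<^esub> b"

definition star_set :: "('a, 'm) ring_scheme \<Rightarrow> 'a set \<Rightarrow> 'a set \<Rightarrow> 'a set" where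
  "star_set A S T = generate (add_monoid A) {star A x y | x y. x \<in> S \<and> y \<in> T}"

text \<open>The cosets in the last conjunct are additive, those implicit in \<open>I \<lhd> A\<close> are taken
  in the circle group.\<close>

definition brace_ideal :: "('a, 'm) ring_scheme \<Rightarrow> 'a set \<Rightarrow> bool" where
  "brace_ideal A I \<longleftrightarrow>
     I \<lhd> A \<and>
     (\<forall>a \<in> carrier A. lam A a ` I \<subseteq> I) \<and>
     (\<forall>a \<in> carrier A. a <+\<^bsub>A\<^esub> I = I +>\<^bsub>A\<^esub> a)"

definition gen_brace_ideal :: "('a, 'm) ring_scheme \<Rightarrow> 'a \<Rightarrow> 'a set" where
  "gen_brace_ideal A a = \<Inter>{I. brace_ideal A I \<and> a \<in> I}"

definition sum_ideals :: "('a, 'm) ring_scheme \<Rightarrow> 'a set set \<Rightarrow> 'a set" where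
  "sum_ideals A S = generate (add_monoid A) (\<Union>S)"

text \<open>Sequences are indexed from \<open>0\<close>, so \<open>s i\<close> is the term $a_{i+1}$.\<close>

definition n_sequence :: "('a, 'm) ring_scheme \<Rightarrow> (nat \<Rightarrow> 'a) \<Rightarrow> bool" where
  "n_sequence A s \<longleftrightarrow>
     (\<forall>i. s i \<in> carrier A \<and>
          s (Suc i) \<in> star_set A (gen_brace_ideal A (s i)) (gen_brace_ideal A (s i)))"

definition baer_radical_ideal :: "('a, 'm) ring_scheme \<Rightarrow> 'a set \<Rightarrow> bool" where
  "baer_radical_ideal A I \<longleftrightarrow>
     brace_ideal A I \<and> (\<forall>s. n_sequence A s \<and> s 0 \<in> I \<longrightarrow> (\<exists>i. s i = \<zero>\<^bsub>A\<^esub>))"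

text \<open>\<open>GREATEST\<close> is with respect to inclusion: the Baer radical ideal containing all others.\<close>

definition baer_radical :: "('a, 'm) ring_scheme \<Rightarrow> 'a set" where
  "baer_radical A = (GREATEST I. baer_radical_ideal A I)"

text \<open>Indices are shifted by one: \<open>left_series A n\<close> is $A^{n+1}$ and
  \<open>right_series A n\<close> is $A^{(n+1)}$.\<close>

primrec left_series :: "('a, 'm) ring_scheme \<Rightarrow> nat \<Rightarrow> 'a set" where
  "left_series A 0 = carrier A"
| "left_series A (Suc n) = star_set A (carrier A) (left_series A n)"

primrec right_series :: "('a, 'm) ring_scheme \<Rightarrow> nat \<Rightarrow> 'a set" where
  "right_series A 0 = carrier A"
| "right_series A (Suc n) = star_set A (right_series A n) (carrier A)"

definition left_nilpotent :: "('a, 'm) ring_scheme \<Rightarrow> bool" where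
  "left_nilpotent A \<longleftrightarrow> (\<exists>n. left_series A n = {\<zero>\<^bsub>A\<^esub>})"

definition right_nilpotent :: "('a, 'm) ring_scheme \<Rightarrow> bool" where
  "right_nilpotent A \<longleftrightarrow> (\<exists>n. right_series A n = {\<zero>\<^bsub>A\<^esub>})"

definition wedderburn_radical :: "('a, 'm) ring_scheme \<Rightarrow> 'a set" where
  "wedderburn_radical A =
     sum_ideals A {I. brace_ideal A I \<and>
       left_nilpotent (A\<lparr>carrier := I\<rparr>) \<and> right_nilpotent (A\<lparr>carrier := I\<rparr>)}"

lemma (in skew_brace) one_eq_zero: "\<one> = \<zero>"
proof -
  have z: "\<zero> \<in> carrier A" using add.one_closed by simp
  have o: "\<one> \<in> carrier A" by simp
  have "\<zero> \<oplus> \<one> = \<one>" using add.l_one o by simp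
  then have "\<zero> \<otimes> \<one> = \<zero> \<otimes> \<zero> \<ominus> \<zero> \<oplus> \<zero> \<otimes> \<one>"
    using brace_distrib[OF z z o] by simp
  then have "\<zero> = \<zero> \<otimes> \<zero> \<oplus> \<zero>"
    using z add.inv_one add.r_one[of "\<zero> \<otimes> \<zero>"] by (simp add: a_minus_def a_inv_def)
  then have "\<zero> \<otimes> \<zero> = \<zero>" using add.r_one[of "\<zero> \<otimes> \<zero>"] z by simp
  then show ?thesis using z mult.l_cancel_one[of \<zero> \<zero>] by simp
qed

end

theory Submission
  imports Defs
begin

text \<open>
  Under \<open>*\<close> a two-sided brace is an associative ring without unit, and its ideals are the
  two-sided ideals of that ring.  A left nilpotent ideal is Baer radical, because the \<open>i\<close>-th term
  of an n-sequence starting in \<open>I\<close> lies in the \<open>i\<close>-th term of the left series of \<open>I\<close>.  Conversely,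
  if no nonzero ideal has zero square, then an n-sequence starting at a nonzero element
  can always be continued by a nonzero element.  The largest Baer radical ideal exists because an
  n-sequence starting in \<open>I + J\<close> is congruent modulo \<open>I\<close> to one starting in \<open>J\<close>.
\<close>

text \<open>
  In \<^locale>\<open>two_sided_brace\<close> the facts on the additive group are inherited from
  \<^locale>\<open>skew_brace\<close> and speak of \<^const>\<open>add_monoid\<close>.  Putting \<^locale>\<open>abelian_group\<close> first
  makes them available in terms of \<open>\<oplus>\<close>, \<open>\<ominus>\<close> and \<open>\<zero>\<close>.
\<close>

locale abelian_two_sided_brace = abelian_group A + mult: group A for A (structure) +
  assumes brace_distrib:
    "\<lbrakk>a \<in> carrier A; b \<in> carrier A; c \<in> carrier A\<rbrakk>
      \<Longrightarrow> a \<otimes> (b \<oplus> c) = a \<otimes> b \<ominus> a \<oplus> a \<otimes> c"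
    and brace_distrib_right:
    "\<lbrakk>a \<in> carrier A; b \<in> carrier A; c \<in> carrier A\<rbrakk>
      \<Longrightarrow> (a \<oplus> b) \<otimes> c = a \<otimes> c \<ominus> c \<oplus> b \<otimes> c"

lemma two_sided_brace_imp_abelian:
  assumes "two_sided_brace A" shows "abelian_two_sided_brace A"
proof -
  interpret two_sided_brace A by fact
  show ?thesis
    by (intro abelian_two_sided_brace.intro abelian_two_sided_brace_axioms.intro)
       (fact abelian_group_axioms mult.group_axioms brace_distrib brace_distrib_right)+
qed

context abelian_two_sided_brace
begin

section \<open>The ring structure given by the star product\<close>

lemma one_eq_zero: "\<one> = \<zero>"
  by (intro skew_brace.one_eq_zero skew_brace.intro skew_brace_axioms.intro)
     (fact a_group mult.group_axioms brace_distrib)+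

lemma star_eq:
  assumes "a \<in> carrier A" "b \<in> carrier A"
  shows "star A a b = a \<otimes> b \<ominus> a \<ominus> b"
  using assms by (simp add: star_def lam_def a_minus_def a_ac)

lemma star_closed [simp, intro]:
  assumes "a \<in> carrier A" "b \<in> carrier A"
  shows "star A a b \<in> carrier A"
  using assms by (simp add: star_eq)

text \<open>The circle operation is the adjoint operation of the star ring: with a formal unit 1,
  the product of \<open>1 + a\<close> and \<open>1 + b\<close> is \<open>1 + a \<otimes> b\<close>.
  Rewriting with this rule turns statements on the circle group into ring computations.\<close>

lemma mult_eq_star:
  assumes "a \<in> carrier A" "b \<in> carrier A"
  shows "a \<otimes> b = a \<oplus> b \<oplus> star A a b"
proof -
  have "a \<oplus> b \<oplus> star A a b = (a \<oplus> \<ominus> a) \<oplus> (b \<oplus> \<ominus> b) \<oplus> a \<otimes> b"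
    using assms by (simp add: star_eq a_minus_def a_ac del: r_neg)
  then show ?thesis using assms by (simp add: r_neg)
qed

lemma lam_eq_star:
  assumes "a \<in> carrier A" "b \<in> carrier A"
  shows "lam A a b = b \<oplus> star A a b"
  using assms by (simp add: lam_def mult_eq_star a_assoc r_neg1)

lemma star_add_right:
  assumes "a \<in> carrier A" "b \<in> carrier A" "c \<in> carrier A"
  shows "star A a (b \<oplus> c) = star A a b \<oplus> star A a c"
  using assms by (simp add: star_eq brace_distrib a_minus_def minus_add a_ac)

lemma star_add_left:
  assumes "a \<in> carrier A" "b \<in> carrier A" "c \<in> carrier A"
  shows "star A (a \<oplus> b) c = star A a c \<oplus> star A b c"
  using assms by (simp add: star_eq brace_distrib_right a_minus_def minus_add a_ac)

text \<open>Associativity of \<open>\<otimes>\<close> is expanded on both sides by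
  \<open>mult_eq_star\<close> and the two distributive laws. The three variables and their three
  pairwise products occur on both sides, and cancelling them leaves the two triple products.\<close>

lemma star_assoc:
  assumes [simp]: "a \<in> carrier A" "b \<in> carrier A" "c \<in> carrier A"
  shows "star A (star A a b) c = star A a (star A b c)"
proof -
  have "(a \<otimes> b) \<otimes> c = a \<otimes> (b \<otimes> c)" by (simp add: mult.m_assoc)
  then have "(a \<oplus> b \<oplus> c \<oplus> star A a b \<oplus> star A a c \<oplus> star A b c) \<oplus> star A (star A a b) c
    = (a \<oplus> b \<oplus> c \<oplus> star A a b \<oplus> star A a c \<oplus> star A b c) \<oplus> star A a (star A b c)"
    by (simp add: mult_eq_star star_add_left star_add_right a_ac)
  then show ?thesis by simp
qed

lemma star_zero_right: "a \<in> carrier A \<Longrightarrow> star A a \<zero> = \<zero>"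
  using star_add_right[of a \<zero> \<zero>] by simp

lemma star_zero_left: "a \<in> carrier A \<Longrightarrow> star A \<zero> a = \<zero>"
  using star_add_left[of \<zero> \<zero> a] by simp

lemma star_minus_right:
  assumes "a \<in> carrier A" "b \<in> carrier A" shows "star A a (\<ominus> b) = \<ominus> star A a b"
  using assms star_add_right[of a "\<ominus> b" b] by (simp add: star_zero_right l_neg minus_equality)

lemma star_minus_left:
  assumes "a \<in> carrier A" "b \<in> carrier A" shows "star A (\<ominus> a) b = \<ominus> star A a b"
  using assms star_add_left[of "\<ominus> a" a b] by (simp add: star_zero_left l_neg minus_equality)

section \<open>Ideals of the brace as two-sided ideals of the star ring\<close>

text \<open>Circle products, circle inverses and conjugates can all be written with
  \<open>\<oplus>\<close>, \<open>\<ominus>\<close> and \<open>star A\<close>, so closure in the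
  ring sense gives a normal subgroup of the circle group.\<close>

lemma brace_idealI:
  assumes sub: "subgroup I (add_monoid A)"
    and l: "\<And>a x. a \<in> carrier A \<Longrightarrow> x \<in> I \<Longrightarrow> star A a x \<in> I"
    and r: "\<And>a x. a \<in> carrier A \<Longrightarrow> x \<in> I \<Longrightarrow> star A x a \<in> I"
  shows "brace_ideal A I"
proof -
  have car: "x \<in> carrier A" if "x \<in> I" for x
    using subgroup.mem_carrier[OF sub that] by simp
  have add: "x \<oplus> y \<in> I" if "x \<in> I" "y \<in> I" for x y
    using subgroup.m_closed[OF sub that] by simp
  have neg: "\<ominus> x \<in> I" if "x \<in> I" for x
    using subgroup.m_inv_closed[OF sub that] by (simp add: a_inv_def)
  have zero: "\<zero> \<in> I" using subgroup.one_closed[OF sub] by simp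
  have inv: "inv x \<in> I" if "x \<in> I" for x
  proof -
    have c: "x \<in> carrier A" "inv x \<in> carrier A" using car that by auto
    \<comment> \<open>This is \<open>x \<otimes> inv x = \<zero>\<close> expanded. It makes
      \<open>inv x\<close> the negative of \<open>x \<oplus> star A x (inv x)\<close>, which lies in
      \<open>I\<close> because \<open>I\<close> absorbs \<open>inv x\<close> as a mere element of
      the carrier.\<close>
    have "x \<oplus> inv x \<oplus> star A x (inv x) = \<zero>"
      using c by (simp flip: mult_eq_star add: one_eq_zero)
    then have "inv x \<oplus> (x \<oplus> star A x (inv x)) = \<zero>" using c by (simp add: a_ac)
    then have "inv x = \<ominus> (x \<oplus> star A x (inv x))" using c by (simp add: minus_equality)
    then show ?thesis using c that add neg r by metis
  qed
  have normal: "x \<otimes> h \<otimes> inv x \<in> I" if x: "x \<in> carrier A" and h: "h \<in> I" for x h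
  proof -
    \<comment> \<open>Chosen so that \<open>x \<otimes> h = x \<oplus> i\<close>. Multiplying by
      \<open>inv x\<close> then splits off the expansion of \<open>x \<otimes> inv x\<close>, which
      vanishes, and what remains involves \<open>i\<close> and stays in \<open>I\<close>.\<close>
    define i where "i = h \<oplus> star A x h"
    have i: "i \<in> I" using x h add l by (simp add: i_def)
    have c: "h \<in> carrier A" "i \<in> carrier A" "inv x \<in> carrier A" using car h i x by auto
    have "x \<otimes> h \<otimes> inv x = (x \<oplus> i) \<otimes> inv x"
      using x c by (simp add: mult_eq_star i_def a_assoc)
    also have "\<dots> = (x \<oplus> inv x \<oplus> star A x (inv x)) \<oplus> (i \<oplus> star A i (inv x))"
      using x c by (simp add: mult_eq_star star_add_left a_ac del: mult.inv_closed)
    also have "x \<oplus> inv x \<oplus> star A x (inv x) = \<zero>"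
      using x c by (simp flip: mult_eq_star add: one_eq_zero)
    finally show ?thesis using x c i add r by simp
  qed
  have "subgroup I A"
    by (rule mult.subgroupI) (use car zero inv in \<open>auto simp: mult_eq_star intro!: add l\<close>)
  then have "I \<lhd> A" using normal by (simp add: mult.normal_inv_iff)
  moreover have "lam A a ` I \<subseteq> I" if "a \<in> carrier A" for a
    using that car l add by (auto simp: lam_eq_star)
  moreover have "a <+ I = I +> a" if "a \<in> carrier A" for a
    using that car by (force simp: a_l_coset_def a_r_coset_def l_coset_def r_coset_def a_comm)
  ultimately show ?thesis by (simp add: brace_ideal_def)
qed

context
  fixes I assumes I: "brace_ideal A I"
begin

lemma brace_ideal_carrier: "x \<in> I \<Longrightarrow> x \<in> carrier A"
  using I subgroup.mem_carrier normal_imp_subgroup by (metis brace_ideal_def)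

lemma brace_ideal_zero: "\<zero> \<in> I"
  using I subgroup.one_closed normal_imp_subgroup one_eq_zero by (metis brace_ideal_def)

lemma brace_ideal_lam: "a \<in> carrier A \<Longrightarrow> x \<in> I \<Longrightarrow> lam A a x \<in> I"
  using I by (auto simp: brace_ideal_def)

lemma brace_ideal_inv: "x \<in> I \<Longrightarrow> inv x \<in> I"
  using I subgroup.m_inv_closed normal_imp_subgroup by (metis brace_ideal_def)

text \<open>The definition of an ideal provides closure in the circle group only. Additive inverses
  come from \<open>lam\<close>, since \<open>lam A x\<close> sends \<open>inv x\<close> to
  \<open>\<ominus> x\<close>.\<close>

lemma brace_ideal_minus: assumes "x \<in> I" shows "\<ominus> x \<in> I"
proof -
  have c: "x \<in> carrier A" using assms by (rule brace_ideal_carrier)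
  then have "lam A x (inv x) = \<ominus> x" by (simp add: lam_def one_eq_zero)
  then show ?thesis using brace_ideal_lam[of x "inv x"] brace_ideal_inv assms c by simp
qed

text \<open>The maps \<open>lam A x\<close> and \<open>lam A (inv x)\<close> are mutually inverse,
  so a sum can be rewritten as a circle product of two elements of \<open>I\<close>:
  \<open>x \<oplus> y = x \<otimes> lam A (inv x) y\<close>.\<close>

lemma brace_ideal_add: assumes "x \<in> I" "y \<in> I" shows "x \<oplus> y \<in> I"
proof -
  have c: "x \<in> carrier A" "y \<in> carrier A" using assms brace_ideal_carrier by auto
  define z where "z = lam A (inv x) y"
  have z: "z \<in> I" using brace_ideal_lam[of "inv x" y] assms c by (simp add: z_def)
  have zc: "z \<in> carrier A" using z by (rule brace_ideal_carrier)
  have "inv x \<oplus> z = inv x \<otimes> y"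
    using c by (simp add: z_def lam_def r_neg1 r_neg2 flip: a_assoc) (simp add: r_neg)
  then have "x \<otimes> (inv x \<oplus> z) = y" using c by (simp flip: mult.m_assoc)
  then have "y = \<ominus> x \<oplus> x \<otimes> z"
    using c zc by (simp add: brace_distrib one_eq_zero a_minus_def)
  then have "x \<oplus> y = x \<otimes> z" using c zc by (simp add: r_neg2)
  also have "\<dots> \<in> I"
    using I assms z subgroup.m_closed normal_imp_subgroup by (metis brace_ideal_def)
  finally show ?thesis .
qed

lemma brace_ideal_subgroup: "subgroup I (add_monoid A)"
  by (rule add.subgroupI)
     (use brace_ideal_carrier brace_ideal_zero brace_ideal_minus brace_ideal_add
      in \<open>auto simp: a_inv_def\<close>)

lemma brace_ideal_star_right:
  assumes "a \<in> carrier A" "x \<in> I" shows "star A a x \<in> I"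
proof -
  have "star A a x = lam A a x \<ominus> x" by (simp add: star_def)
  then show ?thesis using assms
    by (simp add: a_minus_def brace_ideal_lam brace_ideal_minus brace_ideal_add)
qed

text \<open>Normality in the circle group trades left for right: with \<open>z\<close> the conjugate
  of \<open>x\<close> for which \<open>a \<otimes> z = x \<otimes> a\<close>, the product
  \<open>star A x a\<close> becomes \<open>lam A a z \<ominus> x\<close>.\<close>

lemma brace_ideal_star_left:
  assumes a: "a \<in> carrier A" and x: "x \<in> I" shows "star A x a \<in> I"
proof -
  have c: "x \<in> carrier A" using x by (rule brace_ideal_carrier)
  define z where "z = inv a \<otimes> x \<otimes> a"
  have z: "z \<in> I"
    using I a x mult.inv_closed mult.inv_inv unfolding z_def brace_ideal_def mult.normal_inv_iff
    by metis
  have zc: "z \<in> carrier A" using z by (rule brace_ideal_carrier)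
  have "a \<otimes> z = x \<otimes> a" using a c by (simp add: z_def mult.m_assoc flip: mult.m_assoc[of a])
  then have "star A x a = lam A a z \<ominus> x"
    using a c zc by (simp add: star_eq lam_def a_minus_def a_ac)
  then show ?thesis using a z x
    by (simp add: a_minus_def brace_ideal_lam brace_ideal_minus brace_ideal_add)
qed

end

section \<open>Products, sums and intersections of ideals\<close>

lemma brace_ideal_star_set_subset:
  assumes H: "brace_ideal A H" and prod: "\<And>x y. x \<in> X \<Longrightarrow> y \<in> Y \<Longrightarrow> star A x y \<in> H"
  shows "star_set A X Y \<subseteq> H"
  unfolding star_set_def
  by (rule add.generate_subgroup_incl) (use prod brace_ideal_subgroup[OF H] in auto)

lemma star_set_incl: "x \<in> X \<Longrightarrow> y \<in> Y \<Longrightarrow> star A x y \<in> star_set A X Y"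
  unfolding star_set_def by (blast intro: generate.incl)

lemma star_set_mono: "X \<subseteq> X' \<Longrightarrow> Y \<subseteq> Y' \<Longrightarrow> star_set A X Y \<subseteq> star_set A X' Y'"
  unfolding star_set_def by (rule add.mono_generate) blast

text \<open>By associativity an outer factor moves onto the neighbouring ideal element, where it is
  absorbed: a factor on the left goes into \<open>I\<close>, one on the right into \<open>J\<close>.
  Additivity extends this from the generators to the generated subgroup.\<close>

lemma brace_ideal_star_set:
  assumes I: "brace_ideal A I" and J: "brace_ideal A J"
  shows "brace_ideal A (star_set A I J)"
proof -
  let ?S = "{star A x y | x y. x \<in> I \<and> y \<in> J}"
  have S: "?S \<subseteq> carrier A"
    using brace_ideal_carrier[OF I] brace_ideal_carrier[OF J] by auto
  have sub: "subgroup (star_set A I J) (add_monoid A)"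
    unfolding star_set_def by (rule add.generate_is_subgroup) (use S in simp)
  have car: "z \<in> carrier A" if "z \<in> generate (add_monoid A) ?S" for z
    using that S add.generate_in_carrier[of ?S z] by simp
  have neg: "\<ominus> z \<in> generate (add_monoid A) ?S" if "z \<in> generate (add_monoid A) ?S" for z
    using subgroup.m_inv_closed[OF sub] that by (simp add: star_set_def a_inv_def)
  have "star A a z \<in> generate (add_monoid A) ?S \<and> star A z a \<in> generate (add_monoid A) ?S"
    if a: "a \<in> carrier A" and z: "z \<in> generate (add_monoid A) ?S" for a z
    using z
  proof induction
    case one
    then show ?case
      using a generate.one[of "add_monoid A" ?S] by (simp add: star_zero_left star_zero_right)
  next
    case (incl h)
    then obtain x y where h: "h = star A x y" "x \<in> I" "y \<in> J" by blast
    have c: "x \<in> carrier A" "y \<in> carrier A"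
      using h brace_ideal_carrier[OF I] brace_ideal_carrier[OF J] by auto
    have "star A a h = star A (star A a x) y" "star A h a = star A x (star A y a)"
      using h a c by (simp_all add: star_assoc)
    moreover have "star A a x \<in> I" "star A y a \<in> J"
      using a h brace_ideal_star_right[OF I] brace_ideal_star_left[OF J] by auto
    ultimately show ?case using h by (blast intro: generate.incl)
  next
    case (inv h)
    then obtain x y where h: "h = star A x y" "x \<in> I" "y \<in> J" by blast
    have c: "x \<in> carrier A" "y \<in> carrier A"
      using h brace_ideal_carrier[OF I] brace_ideal_carrier[OF J] by auto
    have "star A a h = star A (star A a x) y" "star A h a = star A x (star A y a)"
      using h a c by (simp_all add: star_assoc)
    moreover have "star A a x \<in> I" "star A y a \<in> J"
      using a h brace_ideal_star_right[OF I] brace_ideal_star_left[OF J] by auto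
    ultimately have "star A a h \<in> generate (add_monoid A) ?S"
      "star A h a \<in> generate (add_monoid A) ?S"
      using h by (blast intro: generate.incl)+
    then show ?case
      using neg a c h
      by (simp add: star_minus_left star_minus_right flip: a_inv_def)
  next
    case (eng h1 h2)
    then show ?case
      using a car[OF eng(1)] car[OF eng(2)] generate.eng[of _ "add_monoid A" ?S]
      by (simp add: star_add_left star_add_right)
  qed
  then show ?thesis using sub by (intro brace_idealI) (auto simp: star_set_def)
qed

lemma brace_ideal_set_add:
  assumes I: "brace_ideal A I" and J: "brace_ideal A J"
  shows "brace_ideal A {x \<oplus> y | x y. x \<in> I \<and> y \<in> J}" (is "brace_ideal A ?S")
proof -
  note c = brace_ideal_carrier[OF I] brace_ideal_carrier[OF J]
  show ?thesis
  proof (rule brace_idealI)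
    show "subgroup ?S (add_monoid A)"
    proof (rule add.subgroupI)
      show "?S \<subseteq> carrier A" using c by auto
      show "?S \<noteq> {}" using brace_ideal_zero[OF I] brace_ideal_zero[OF J] by blast
    next
      fix a assume "a \<in> ?S"
      then obtain x y where xy: "a = x \<oplus> y" "x \<in> I" "y \<in> J" by blast
      then have "\<ominus> a = \<ominus> x \<oplus> \<ominus> y" using c by (simp add: minus_add)
      then show "\<ominus> a \<in> ?S"
        using xy brace_ideal_minus[OF I] brace_ideal_minus[OF J] by fastforce
    next
      fix a b assume "a \<in> ?S" "b \<in> ?S"
      then obtain x y u v where xy: "a = x \<oplus> y" "x \<in> I" "y \<in> J" "b = u \<oplus> v" "u \<in> I" "v \<in> J"
        by blast
      then have "a \<oplus> b = (x \<oplus> u) \<oplus> (y \<oplus> v)" using c by (simp add: a_ac)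
      then show "a \<oplus> b \<in> ?S"
        using brace_ideal_add[OF I xy(2,5)] brace_ideal_add[OF J xy(3,6)] by blast
    qed
  next
    fix a s assume a: "a \<in> carrier A" and "s \<in> ?S"
    then obtain x y where xy: "s = x \<oplus> y" "x \<in> I" "y \<in> J" by blast
    have "star A a x \<in> I" "star A a y \<in> J" "star A x a \<in> I" "star A y a \<in> J"
      using a xy brace_ideal_star_left[OF I] brace_ideal_star_left[OF J]
        brace_ideal_star_right[OF I] brace_ideal_star_right[OF J] by simp_all
    moreover have "star A a s = star A a x \<oplus> star A a y" "star A s a = star A x a \<oplus> star A y a"
      using xy a c by (simp_all add: star_add_left star_add_right)
    ultimately show "star A a s \<in> ?S" "star A s a \<in> ?S" by blast+
  qed
qed

lemma brace_ideal_Inter: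
  assumes "S \<noteq> {}" "\<And>I. I \<in> S \<Longrightarrow> brace_ideal A I"
  shows "brace_ideal A (\<Inter>S)"
  by (rule brace_idealI[OF add.subgroups_Inter])
     (use assms brace_ideal_subgroup brace_ideal_star_left brace_ideal_star_right in auto)

lemma brace_ideal_whole: "brace_ideal A (carrier A)"
  by (rule brace_idealI) (use add.subgroup_self in simp_all)

lemma brace_ideal_trivial: "brace_ideal A {\<zero>}"
  by (rule brace_idealI)
     (use add.triv_subgroup in \<open>simp_all add: star_zero_left star_zero_right\<close>)

lemma gen_brace_ideal_ideal: "a \<in> carrier A \<Longrightarrow> brace_ideal A (gen_brace_ideal A a)"
  unfolding gen_brace_ideal_def by (rule brace_ideal_Inter) (use brace_ideal_whole in auto)

lemma gen_brace_ideal_self: "a \<in> gen_brace_ideal A a"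
  by (simp add: gen_brace_ideal_def)

lemma gen_brace_ideal_least: "brace_ideal A I \<Longrightarrow> a \<in> I \<Longrightarrow> gen_brace_ideal A a \<subseteq> I"
  unfolding gen_brace_ideal_def by blast

lemma star_set_ideal_subset_right:
  assumes "brace_ideal A J" "X \<subseteq> carrier A" shows "star_set A X J \<subseteq> J"
  using assms by (intro brace_ideal_star_set_subset) (auto intro: brace_ideal_star_right)

text \<open>The carrier enters \<open>star\<close> and \<open>generate\<close> only through additive
  inverses, and these agree because \<open>I\<close> is an additive subgroup. The lemma lets the
  nilpotency series of \<open>I\<close> as a brace of its own be computed inside
  \<open>A\<close>.\<close>

lemma star_set_restrict:
  assumes I: "brace_ideal A I" and X: "X \<subseteq> I" "Y \<subseteq> I"
  shows "star_set (A\<lparr>carrier := I\<rparr>) X Y = star_set A X Y"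
proof -
  have sub: "subgroup I (add_monoid A)" using I by (rule brace_ideal_subgroup)
  have mon: "add_monoid (A\<lparr>carrier := I\<rparr>) = (add_monoid A)\<lparr>carrier := I\<rparr>" by simp
  have neg: "a_inv (A\<lparr>carrier := I\<rparr>) x = \<ominus> x" if "x \<in> I" for x
    unfolding a_inv_def mon using a_group sub that by (rule group.m_inv_consistent)
  have star: "star (A\<lparr>carrier := I\<rparr>) x y = star A x y" if "x \<in> X" "y \<in> Y" for x y
  proof -
    have "x \<in> I" "y \<in> I" using that X by auto
    then show ?thesis by (simp add: star_def lam_def a_minus_def neg)
  qed
  have eq: "{star (A\<lparr>carrier := I\<rparr>) x y | x y. x \<in> X \<and> y \<in> Y}
      = {star A x y | x y. x \<in> X \<and> y \<in> Y}"
    using star by (intro Collect_cong) (metis (no_types))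
  show ?thesis
    unfolding star_set_def mon eq
    by (rule add.generate_consistent)
       (use X sub brace_ideal_carrier[OF I] brace_ideal_star_left[OF I] in \<open>auto simp: subset_eq\<close>)
qed

section \<open>Baer radical ideals and the existence of a largest one\<close>

lemma n_sequence_shift: "n_sequence A s \<Longrightarrow> n_sequence A (\<lambda>i. s (i + k))"
  by (simp add: n_sequence_def)

lemma left_nilpotent_imp_baer_radical_ideal:
  assumes I: "brace_ideal A I" and nil: "left_nilpotent (A\<lparr>carrier := I\<rparr>)"
  shows "baer_radical_ideal A I"
proof -
  let ?L = "left_series (A\<lparr>carrier := I\<rparr>)"
  \<comment> \<open>The terms of the series have to be ideals of all of \<open>A\<close>, not just
    of \<open>I\<close>, because the ideals in an n-sequence are generated in
    \<open>A\<close>.\<close>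
  have L: "brace_ideal A (?L n) \<and> ?L n \<subseteq> I" for n
  proof (induction n)
    case 0 then show ?case using I by simp
  next
    case (Suc n)
    have "star_set A I (?L n) \<subseteq> ?L n"
      using Suc brace_ideal_carrier[OF I] by (intro star_set_ideal_subset_right) auto
    then show ?case using Suc I by (auto simp: star_set_restrict brace_ideal_star_set)
  qed
  have "\<exists>i. s i = \<zero>" if s: "n_sequence A s" "s 0 \<in> I" for s
  proof -
    have "s n \<in> ?L n" for n
    proof (induction n)
      case 0 then show ?case using s by simp
    next
      case (Suc n)
      have "s (Suc n) \<in> star_set A (gen_brace_ideal A (s n)) (gen_brace_ideal A (s n))"
        using s(1) by (simp add: n_sequence_def)
      \<comment> \<open>The ideal generated by \<open>s n\<close> is bounded by \<open>I\<close> as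
        the left factor and by \<open>?L n\<close> as the right factor.\<close>
      also have "\<dots> \<subseteq> star_set A I (?L n)"
        using Suc L[of n] gen_brace_ideal_least I by (intro star_set_mono) blast+
      finally show ?case using L[of n] I by (simp add: star_set_restrict)
    qed
    moreover obtain n where "?L n = {\<zero>}" using nil by (auto simp: left_nilpotent_def)
    ultimately show ?thesis by blast
  qed
  then show ?thesis using I by (simp add: baer_radical_ideal_def)
qed

text \<open>This does the work of passing to the quotient by \<open>I\<close>. The ideal generated
  by \<open>u \<oplus> x\<close> lies in the sum of \<open>I\<close> and the ideal generated by
  \<open>x\<close>; in a product of two such sums, every term with a factor from \<open>I\<close> is
  absorbed by \<open>I\<close>.\<close>

lemma star_set_gen_add_subset:
  assumes I: "brace_ideal A I" and u: "u \<in> I" and x: "x \<in> carrier A"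
  shows "star_set A (gen_brace_ideal A (u \<oplus> x)) (gen_brace_ideal A (u \<oplus> x))
    \<subseteq> {v \<oplus> y | v y. v \<in> I \<and> y \<in> star_set A (gen_brace_ideal A x) (gen_brace_ideal A x)}"
    (is "_ \<subseteq> ?T")
proof -
  let ?X = "gen_brace_ideal A x"
  have X: "brace_ideal A ?X" using x by (rule gen_brace_ideal_ideal)
  note c = brace_ideal_carrier[OF I] brace_ideal_carrier[OF X]
  have sub: "gen_brace_ideal A (u \<oplus> x) \<subseteq> {v \<oplus> y | v y. v \<in> I \<and> y \<in> ?X}"
    by (rule gen_brace_ideal_least[OF brace_ideal_set_add[OF I X]])
       (use u gen_brace_ideal_self in blast)
  have "brace_ideal A ?T" by (intro brace_ideal_set_add brace_ideal_star_set I X)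
  then show ?thesis
  proof (rule brace_ideal_star_set_subset)
    fix p q assume "p \<in> gen_brace_ideal A (u \<oplus> x)" "q \<in> gen_brace_ideal A (u \<oplus> x)"
    then obtain v y w z where p: "p = v \<oplus> y" "v \<in> I" "y \<in> ?X" and q: "q = w \<oplus> z" "w \<in> I" "z \<in> ?X"
      using sub by blast
    have pq: "v \<in> carrier A" "y \<in> carrier A" "w \<in> carrier A" "z \<in> carrier A"
      using p q c by blast+
    then have "star A p q = (star A v w \<oplus> star A v z \<oplus> star A y w) \<oplus> star A y z"
      unfolding p q by (simp add: star_add_left star_add_right a_ac)
    moreover have "star A v w \<oplus> star A v z \<oplus> star A y w \<in> I"
      using p q pq by (intro brace_ideal_add[OF I])
        (auto intro: brace_ideal_star_left[OF I] brace_ideal_star_right[OF I])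
    moreover have "star A y z \<in> star_set A ?X ?X" using p q by (intro star_set_incl)
    ultimately show "star A p q \<in> ?T" by blast
  qed
qed

lemma baer_radical_ideal_set_add:
  assumes I: "baer_radical_ideal A I" and J: "baer_radical_ideal A J"
  shows "baer_radical_ideal A {x \<oplus> y | x y. x \<in> I \<and> y \<in> J}"
proof -
  have Ii: "brace_ideal A I" and Ji: "brace_ideal A J"
    using I J by (auto simp: baer_radical_ideal_def)
  have "\<exists>i. s i = \<zero>" if s: "n_sequence A s" and s0: "s 0 \<in> {x \<oplus> y | x y. x \<in> I \<and> y \<in> J}" for s
  proof -
    \<comment> \<open>A sequence \<open>t\<close> is built with \<open>t n\<close> congruent to
      \<open>s n\<close> modulo \<open>I\<close>. The index of \<open>P\<close> serves to fix its
      start in \<open>J\<close>; \<open>Q\<close> makes it an n-sequence.\<close>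
    define P where "P n x \<longleftrightarrow> x \<in> carrier A \<and> (\<exists>u\<in>I. s n = u \<oplus> x) \<and> (n = 0 \<longrightarrow> x \<in> J)" for n x
    define Q where "Q x y \<longleftrightarrow> y \<in> star_set A (gen_brace_ideal A x) (gen_brace_ideal A x)" for x y
    have "\<exists>t. \<forall>n. P n (t n) \<and> Q (t n) (t (Suc n))"
    proof (rule dependent_nat_choice)
      show "\<exists>x. P 0 x" using s0 brace_ideal_carrier[OF Ji] by (auto simp: P_def)
    next
      fix x n assume "P n x"
      then obtain u where x: "x \<in> carrier A" "u \<in> I" "s n = u \<oplus> x" by (auto simp: P_def)
      have "s (Suc n) \<in> star_set A (gen_brace_ideal A (u \<oplus> x)) (gen_brace_ideal A (u \<oplus> x))"
        using s x(3) by (metis n_sequence_def)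
      then obtain v y where y: "v \<in> I" "s (Suc n) = v \<oplus> y" "Q x y"
        using star_set_gen_add_subset[OF Ii x(2,1)] unfolding Q_def by blast
      have "brace_ideal A (star_set A (gen_brace_ideal A x) (gen_brace_ideal A x))"
        using x by (intro brace_ideal_star_set gen_brace_ideal_ideal)
      then have "y \<in> carrier A" using y brace_ideal_carrier unfolding Q_def by blast
      then show "\<exists>y. P (Suc n) y \<and> Q x y" using y by (auto simp: P_def)
    qed
    then obtain t where t: "\<And>n. P n (t n)" "\<And>n. Q (t n) (t (Suc n))" by blast
    then have "n_sequence A t" "t 0 \<in> J" by (auto simp: n_sequence_def P_def Q_def)
    then obtain k where "t k = \<zero>" using J by (auto simp: baer_radical_ideal_def)
    then obtain u where "u \<in> I" "s k = u \<oplus> \<zero>" using t(1)[of k] by (auto simp: P_def)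
    then have "s k \<in> I" using brace_ideal_carrier[OF Ii] by simp
    \<comment> \<open>Where \<open>t\<close> vanishes, \<open>s\<close> has entered
      \<open>I\<close>, so the tail of \<open>s\<close> is an n-sequence starting in the Baer
      radical ideal \<open>I\<close>.\<close>
    then obtain i where "s (i + k) = \<zero>"
      using I n_sequence_shift[OF s, of k] unfolding baer_radical_ideal_def
      by (metis (no_types, lifting) add_0)
    then show ?thesis by blast
  qed
  then show ?thesis using brace_ideal_set_add[OF Ii Ji] by (simp add: baer_radical_ideal_def)
qed

text \<open>The family is directed, since the sum of two members is again a member; hence its union
  is closed under addition. An n-sequence starting in the union starts in a single member and so
  reaches zero.\<close>

lemma baer_radical_ideal_Union:
  "baer_radical_ideal A (\<Union>{I. baer_radical_ideal A I})" (is "baer_radical_ideal A ?U")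
proof -
  have ideal: "brace_ideal A I" if "baer_radical_ideal A I" for I
    using that by (simp add: baer_radical_ideal_def)
  have "baer_radical_ideal A {\<zero>}"
    using brace_ideal_trivial by (auto simp: baer_radical_ideal_def)
  then have ne: "?U \<noteq> {}" by blast
  have "subgroup ?U (add_monoid A)"
  proof (rule add.subgroupI)
    show "?U \<subseteq> carrier A" using ideal brace_ideal_carrier by auto
    show "?U \<noteq> {}" by (fact ne)
    show "\<ominus> a \<in> ?U" if "a \<in> ?U" for a
      using that ideal brace_ideal_minus by blast
  next
    fix a b assume "a \<in> ?U" "b \<in> ?U"
    then obtain I J where "baer_radical_ideal A I" "baer_radical_ideal A J" "a \<in> I" "b \<in> J"
      by blast
    then show "a \<oplus> b \<in> ?U"
      using baer_radical_ideal_set_add[of I J] by auto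
  qed
  then have "brace_ideal A ?U"
    by (rule brace_idealI) (use ideal brace_ideal_star_left brace_ideal_star_right in blast)+
  then show ?thesis by (auto simp: baer_radical_ideal_def)
qed

text \<open>The union is itself a member of the family, so it is the maximum that
  \<open>GREATEST\<close> selects.\<close>

lemma baer_radical_eq_Union: "baer_radical A = \<Union>{I. baer_radical_ideal A I}"
  unfolding baer_radical_def
  by (rule Greatest_equality) (use baer_radical_ideal_Union in auto)

section \<open>Square-zero ideals and sequences that never vanish\<close>

lemma square_zero_ideal_subset_wedderburn:
  assumes I: "brace_ideal A I" and sq: "star_set A I I = {\<zero>}"
  shows "I \<subseteq> wedderburn_radical A"
proof -
  have "left_nilpotent (A\<lparr>carrier := I\<rparr>)" "right_nilpotent (A\<lparr>carrier := I\<rparr>)"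
    unfolding left_nilpotent_def right_nilpotent_def
    \<comment> \<open>With the shifted indices, term 1 of either series is the square of
      \<open>I\<close>.\<close>
    by (rule exI[of _ 1], simp add: star_set_restrict[OF I] sq)+
  then show ?thesis using I
    unfolding wedderburn_radical_def sum_ideals_def by (blast intro: generate.incl)
qed

lemma nonvanishing_n_sequence:
  assumes W: "wedderburn_radical A = {\<zero>}" and a: "a \<in> carrier A" "a \<noteq> \<zero>"
  obtains s where "n_sequence A s" "s 0 = a" "\<And>i. s i \<noteq> \<zero>"
proof -
  define P where "P n x \<longleftrightarrow> x \<in> carrier A \<and> x \<noteq> \<zero> \<and> (n = (0::nat) \<longrightarrow> x = a)" for n x
  define Q where "Q x y \<longleftrightarrow> y \<in> star_set A (gen_brace_ideal A x) (gen_brace_ideal A x)" for x y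
  have "\<exists>t. \<forall>n. P n (t n) \<and> Q (t n) (t (Suc n))"
  proof (rule dependent_nat_choice)
    show "\<exists>x. P 0 x" using a by (auto simp: P_def)
  next
    fix x n assume "P n x"
    then have x: "x \<in> carrier A" "x \<noteq> \<zero>" by (auto simp: P_def)
    let ?X = "gen_brace_ideal A x"
    have X: "brace_ideal A ?X" using x by (simp add: gen_brace_ideal_ideal)
    have XX: "brace_ideal A (star_set A ?X ?X)" using X X by (rule brace_ideal_star_set)
    \<comment> \<open>Otherwise the ideal generated by \<open>x\<close> would lie in the Wedderburn
      radical, forcing \<open>x = \<zero>\<close>.\<close>
    have "star_set A ?X ?X \<noteq> {\<zero>}"
      using square_zero_ideal_subset_wedderburn[OF X] W gen_brace_ideal_self[of x] x by blast
    then obtain y where "y \<in> star_set A ?X ?X" "y \<noteq> \<zero>"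
      using brace_ideal_zero[OF XX] by blast
    then show "\<exists>y. P (Suc n) y \<and> Q x y"
      using brace_ideal_carrier[OF XX] by (auto simp: P_def Q_def)
  qed
  then obtain t where "\<And>n. P n (t n)" "\<And>n. Q (t n) (t (Suc n))" by blast
  then show thesis by (intro that[of t]) (auto simp: n_sequence_def P_def Q_def)
qed

end

theorem theorem4p28:
  fixes A :: "('a, 'm) ring_scheme" (structure)
  assumes "two_sided_brace A"
  shows "baer_radical A = {\<zero>} \<longleftrightarrow> wedderburn_radical A = {\<zero>}"
proof
  interpret abelian_two_sided_brace A using assms by (rule two_sided_brace_imp_abelian)
  assume B: "baer_radical A = {\<zero>}"
  let ?S = "{I. brace_ideal A I \<and>
    left_nilpotent (A\<lparr>carrier := I\<rparr>) \<and> right_nilpotent (A\<lparr>carrier := I\<rparr>)}"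
  \<comment> \<open>Each ideal in \<open>?S\<close> is Baer radical by left nilpotency, hence
    contained in the Baer radical.\<close>
  have "\<Union>?S \<subseteq> {\<zero>}"
    using B left_nilpotent_imp_baer_radical_ideal unfolding baer_radical_eq_Union by blast
  then have "generate (add_monoid A) (\<Union>?S) \<subseteq> {\<zero>}"
    by (rule add.generate_subgroup_incl) (rule brace_ideal_subgroup[OF brace_ideal_trivial])
  then show "wedderburn_radical A = {\<zero>}"
    using generate.one[of "add_monoid A" "\<Union>?S"]
    unfolding wedderburn_radical_def sum_ideals_def by auto
next
  interpret abelian_two_sided_brace A using assms by (rule two_sided_brace_imp_abelian)
  assume W: "wedderburn_radical A = {\<zero>}"
  \<comment> \<open>Since the Baer radical is a Baer radical ideal itself, a never vanishing
    n-sequence starting at one of its elements is a contradiction.\<close>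
  have B: "baer_radical_ideal A (baer_radical A)"
    using baer_radical_ideal_Union by (simp add: baer_radical_eq_Union)
  then have ideal: "brace_ideal A (baer_radical A)" by (simp add: baer_radical_ideal_def)
  have "a = \<zero>" if a: "a \<in> baer_radical A" for a
  proof (rule ccontr)
    assume "a \<noteq> \<zero>"
    then obtain s where "n_sequence A s" "s 0 = a" "\<And>i. s i \<noteq> \<zero>"
      using nonvanishing_n_sequence[OF W brace_ideal_carrier[OF ideal a]] by blast
    then show False using B a by (auto simp: baer_radical_ideal_def)
  qed
  then show "baer_radical A = {\<zero>}" using brace_ideal_zero[OF ideal] by blast
qed

end
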